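(* Let $p_0\in(0,1)$, $p_1,p_2\in(0.5,1]$ and $1\le x_L<x_U<\infty$. There is exactly one $D$-optimal design $\xi_D$ on $[x_L,x_U]$ for estimating $\theta=(p_0,p_1,p_2)^{\mathrm T}$, that is, exactly one design maximizing $\log|M(\xi)|$ among all designs under which $\theta$ is estimable. It has exactly three group sizes $x_L<x_2^*<x_U$, each with weight $1/3$, where $$x_2^*-x_L=\frac{\log(A_1)}{\log(1-p_0)}$$ and $A_1$ is the unique solution $a\in(r,1)$ of the equation $$\frac{2}{a}\left(1+\frac{1+\Delta_0\cdot\frac1a}{\log(a)-\Delta_0\left(\frac1a-1\right)}\right)=\frac{1}{\delta c+a}-\frac{1}{c-a}.$$
   Context: Group testing model: $p_0$, $p_1$, $p_2$ are the prevalence, sensitivity and specificity, and $\theta=(p_0,p_1,p_2)^{\mathrm T}$. The probability of a positive response for a trial with group size $x$ is $$\pi(x)=p_1-(p_1+p_2-1)(1-p_0)^x .$$ Group sizes $x$ are real numbers in $[x_L,x_U]$. An (approximate) design is a finitely supported probability measure on $[x_L,x_U]$, written $\xi=\{(x_i,w_i)\}_{i=1}^k$, with $k\ge1$ arbitrary, distinct group sizes (support points) $x_1<\cdots<x_k$ in $[x_L,x_U]$ and weights $w_i>0$, $\sum_i w_i=1$. Its Fisher information matrix is the $3\times3$ matrix $$M(\xi)=\sum_{i=1}^k w_i\lambda(x_i)f(x_i)f(x_i)^{\mathrm T},\qquad \lambda(x)=[\pi(x)(1-\pi(x))]^{-1},$$ where $f(x)=(f_0(x),f_1(x),f_2(x))^{\mathrm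 T}$ is the gradient of $\pi(x)$ in $\theta$: $$f_0(x)=x(p_1+p_2-1)(1-p_0)^{x-1},\quad f_1(x)=1-(1-p_0)^x,\quad f_2(x)=-(1-p_0)^x .$$ The vector $\theta$ is estimable under $\xi$ if $M(\xi)$ is nonsingular. $|\cdot|$ denotes the determinant. Constants: $$c=\frac{p_1}{(p_1+p_2-1)(1-p_0)^{x_L}}>1,\quad \delta=\frac{1-p_1}{p_1}\in[0,1),\quad r=(1-p_0)^{x_U-x_L}\in(0,1),\quad \Delta_0=\frac{r\log r}{1-r}.$$ *)

theory Defs
  imports "HOL-Analysis.Analysis" "HOL-Probability.Probability_Mass_Function"
begin

text \<open>Group testing with prevalence \<open>p0\<close>, sensitivity \<open>p1\<close> and specificity \<open>p2\<close>. Group sizes are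
  real, so powers of \<open>1 - p0\<close> are taken with \<open>powr\<close>; the base is positive for \<open>p0 \<in> (0,1)\<close>.\<close>

definition response_prob :: "real \<Rightarrow> real \<Rightarrow> real \<Rightarrow> real \<Rightarrow> real" where
  "response_prob p0 p1 p2 x = p1 - (p1 + p2 - 1) * (1 - p0) powr x"

definition response_grad :: "real \<Rightarrow> real \<Rightarrow> real \<Rightarrow> real \<Rightarrow> real ^ 3" where
  "response_grad p0 p1 p2 x =
     vector [x * (p1 + p2 - 1) * (1 - p0) powr (x - 1),
             1 - (1 - p0) powr x,
             - ((1 - p0) powr x)]"

lemma GDERIV_response_prob:
  assumes "p0 < 1"
  shows "GDERIV (\<lambda>\<theta>::real ^ 3. response_prob (\<theta> $ 1) (\<theta> $ 2) (\<theta> $ 3) x) (vector [p0, p1, p2])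
           :> response_grad p0 p1 p2 x"
proof -
  have nth: "((\<lambda>\<theta>::real ^ 3. \<theta> $ i) has_derivative (\<lambda>h. h $ i)) (at t)" for i t
    by (rule bounded_linear_imp_has_derivative[OF bounded_linear_vec_nth])
  show ?thesis
    unfolding gderiv_def response_prob_def
    apply (rule has_derivative_eq_rhs)
     apply (rule derivative_intros nth)+
    using assms
    apply (auto simp: response_grad_def inner_vec_def sum_3 vector_3 powr_diff field_simps)
    done
qed

definition response_weight :: "real \<Rightarrow> real \<Rightarrow> real \<Rightarrow> real \<Rightarrow> real" where
  "response_weight p0 p1 p2 x =
     inverse (response_prob p0 p1 p2 x * (1 - response_prob p0 p1 p2 x))"

text \<open>A design is a finitely supported probability mass function: the support points are the
  elements of its support \<open>set_pmf \<xi>\<close>, and the weight at \<open>x\<close> is \<open>pmf \<xi> x\<close>.\<close>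

definition designs :: "real \<Rightarrow> real \<Rightarrow> real pmf set" where
  "designs xL xU = {\<xi>. finite (set_pmf \<xi>) \<and> set_pmf \<xi> \<subseteq> {xL..xU}}"

definition fisher_info :: "real \<Rightarrow> real \<Rightarrow> real \<Rightarrow> real pmf \<Rightarrow> real ^ 3 ^ 3" where
  "fisher_info p0 p1 p2 \<xi> =
     (\<Sum>x\<in>set_pmf \<xi>. (pmf \<xi> x * response_weight p0 p1 p2 x) *\<^sub>R
        (\<chi> i j. response_grad p0 p1 p2 x $ i * response_grad p0 p1 p2 x $ j))"

definition estimable :: "real \<Rightarrow> real \<Rightarrow> real \<Rightarrow> real pmf \<Rightarrow> bool" where
  "estimable p0 p1 p2 \<xi> \<longleftrightarrow> invertible (fisher_info p0 p1 p2 \<xi>)"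

definition D_optimal :: "real \<Rightarrow> real \<Rightarrow> real \<Rightarrow> real \<Rightarrow> real \<Rightarrow> real pmf \<Rightarrow> bool" where
  "D_optimal p0 p1 p2 xL xU \<xi> \<longleftrightarrow>
     \<xi> \<in> designs xL xU \<and> estimable p0 p1 p2 \<xi> \<and>
     (\<forall>\<eta>\<in>designs xL xU. estimable p0 p1 p2 \<eta> \<longrightarrow>
        ln (det (fisher_info p0 p1 p2 \<eta>)) \<le> ln (det (fisher_info p0 p1 p2 \<xi>)))"

definition const_c :: "real \<Rightarrow> real \<Rightarrow> real \<Rightarrow> real \<Rightarrow> real" where
  "const_c p0 p1 p2 xL = p1 / ((p1 + p2 - 1) * (1 - p0) powr xL)"

definition const_delta :: "real \<Rightarrow> real" where
  "const_delta p1 = (1 - p1) / p1"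

definition const_r :: "real \<Rightarrow> real \<Rightarrow> real \<Rightarrow> real" where
  "const_r p0 xL xU = (1 - p0) powr (xU - xL)"

definition const_Delta0 :: "real \<Rightarrow> real \<Rightarrow> real \<Rightarrow> real" where
  "const_Delta0 p0 xL xU =
     const_r p0 xL xU * ln (const_r p0 xL xU) / (1 - const_r p0 xL xU)"

text \<open>On \<open>(r,1)\<close> none of the denominators below vanishes, since \<open>\<delta> c \<ge> 0\<close>, \<open>c > 1\<close>, and
  \<open>ln a - \<Delta>\<^sub>0 (1/a - 1)\<close> is strictly convex in \<open>1/a\<close> with zeros exactly at \<open>a = 1\<close> and \<open>a = r\<close>.\<close>

definition A1_root :: "real \<Rightarrow> real \<Rightarrow> real \<Rightarrow> real \<Rightarrow> real \<Rightarrow> real \<Rightarrow> bool" where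
  "A1_root p0 p1 p2 xL xU a \<longleftrightarrow>
     (let c = const_c p0 p1 p2 xL; \<delta> = const_delta p1;
          r = const_r p0 xL xU; \<Delta>0 = const_Delta0 p0 xL xU
      in a \<in> {r<..<1} \<and>
         2 / a * (1 + (1 + \<Delta>0 * (1 / a)) / (ln a - \<Delta>0 * (1 / a - 1)))
           = 1 / (\<delta> * c + a) - 1 / (c - a))"

end

theory Submission
  imports Defs
begin

text \<open>Substituting \<open>u = (1 - p0) powr (x - xL) \<in> [r,1]\<close> turns the model, up to a linear change of basis,
  into regression on \<open>(1, u, u ln u)\<close> with variance \<open>h u = (c - u) (\<delta> c + u)\<close>. Let \<open>l1, l2, l3\<close> be the
  Lagrange basis for nodes \<open>r < a < 1\<close>. By Hadamard's inequality and the inequality of arithmetic and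
  geometric means, the uniform design on the nodes is the only D-optimal one as soon as
  \<open>d u = h r (l1 u)\<^sup>2 + h a (l2 u)\<^sup>2 + h 1 (l3 u)\<^sup>2 - h u\<close> is negative on \<open>[r,1]\<close> off the nodes. The equation
  for \<open>A\<^sub>1\<close> says exactly that \<open>d' a = 0\<close>. Convexity of \<open>u ln u\<close> gives \<open>d' r < 0 < d' 1\<close>; were \<open>d\<close> nonnegative
  at a further point, \<open>d'\<close> would change sign too often, because \<open>(u d'')'\<close> is a quadratic polynomial in
  \<open>ln u\<close>. A root \<open>A\<^sub>1\<close> exists by the intermediate value theorem, and it is unique because every root
  yields an optimal design.\<close>

section \<open>Sign changes of combinations of powers and logarithms\<close>

text \<open>The second divided difference of a quadratic is its leading coefficient. The signs at
  \<open>y1, y2, y3\<close> force \<open>k2 < 0\<close>, those at \<open>y2, y3, y4\<close> force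
  \<open>0 < k2\<close>.\<close>

lemma quadratic_sign_changes:
  fixes y1 y2 y3 y4 k0 k1 k2 :: real
  defines "q \<equiv> \<lambda>y. k0 + k1 * y + k2 * y^2"
  assumes "y1 < y2" "y2 < y3" "y3 < y4" and "q y1 < 0" "0 < q y2" "q y3 < 0" "0 < q y4"
  shows False
proof -
  have id: "q x * (z - y) + q z * (y - x) - q y * (z - x) = k2 * ((z - y) * (y - x) * (z - x))" for x y z
    unfolding q_def by algebra
  have "q y1 * (y3 - y2) < 0" "q y3 * (y2 - y1) < 0" "0 < q y2 * (y3 - y1)"
    "0 < q y2 * (y4 - y3)" "0 < q y4 * (y3 - y2)" "q y3 * (y4 - y2) < 0"
    using assms by (simp_all add: mult_neg_pos)
  then have "k2 * ((y3 - y2) * (y2 - y1) * (y3 - y1)) < 0" "0 < k2 * ((y4 - y3) * (y3 - y2) * (y4 - y2))"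
    using id[of y1 y3 y2] id[of y2 y4 y3] by linarith+
  moreover have "0 < (y3 - y2) * (y2 - y1) * (y3 - y1)" "0 < (y4 - y3) * (y3 - y2) * (y4 - y2)"
    using assms by simp_all
  ultimately show False
    by (smt (verit) mult_nonneg_nonneg mult_nonpos_nonneg)
qed

lemma MVT_deriv:
  fixes f f' :: "real \<Rightarrow> real"
  assumes "x < y" and "\<And>u. x \<le> u \<Longrightarrow> u \<le> y \<Longrightarrow> (f has_real_derivative f' u) (at u)"
  obtains z where "x < z" "z < y" "f y - f x = (y - x) * f' z"
  using MVT2[OF assms] by blast

lemma MVT_deriv_pos:
  fixes f f' :: "real \<Rightarrow> real"
  assumes "x < y" and "\<And>u. x \<le> u \<Longrightarrow> u \<le> y \<Longrightarrow> (f has_real_derivative f' u) (at u)" and "f x < f y"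
  obtains z where "x < z" "z < y" "0 < f' z"
  using MVT_deriv[OF assms(1,2)] assms(1,3) by (smt (verit) mult_nonneg_nonpos)

lemma MVT_deriv_neg:
  fixes f f' :: "real \<Rightarrow> real"
  assumes "x < y" and "\<And>u. x \<le> u \<Longrightarrow> u \<le> y \<Longrightarrow> (f has_real_derivative f' u) (at u)" and "f y < f x"
  obtains z where "x < z" "z < y" "f' z < 0"
  using MVT_deriv[OF assms(1,2)] assms(1,3) by (smt (verit) mult_nonneg_nonneg)

lemma MVT_deriv_nonneg:
  fixes f f' :: "real \<Rightarrow> real"
  assumes "x < y" and "\<And>u. x \<le> u \<Longrightarrow> u \<le> y \<Longrightarrow> (f has_real_derivative f' u) (at u)" and "f x \<le> f y"
  obtains z where "x < z" "z < y" "0 \<le> f' z"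
  using MVT_deriv[OF assms(1,2)] assms(1,3) by (smt (verit) mult_pos_neg)

lemma MVT_deriv_nonpos:
  fixes f f' :: "real \<Rightarrow> real"
  assumes "x < y" and "\<And>u. x \<le> u \<Longrightarrow> u \<le> y \<Longrightarrow> (f has_real_derivative f' u) (at u)" and "f y \<le> f x"
  obtains z where "x < z" "z < y" "f' z \<le> 0"
  using MVT_deriv[OF assms(1,2)] assms(1,3) by (smt (verit) mult_pos_pos)

text \<open>The span of the pairwise products of \<open>1\<close>, \<open>u\<close> and
  \<open>u * ln u\<close>. It contains the squared Lagrange functions as well as the variance
  \<open>h\<close>.\<close>

definition log_poly :: "real \<Rightarrow> real \<Rightarrow> real \<Rightarrow> real \<Rightarrow> real \<Rightarrow> real \<Rightarrow> real \<Rightarrow> real" where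
  "log_poly k0 k1 k2 k3 k4 k5 u =
     k0 + k1 * u + k2 * (u * ln u) + k3 * u^2 + k4 * (u^2 * ln u) + k5 * (u * ln u)^2"

definition log_poly_deriv :: "real \<Rightarrow> real \<Rightarrow> real \<Rightarrow> real \<Rightarrow> real \<Rightarrow> real \<Rightarrow> real" where
  "log_poly_deriv k1 k2 k3 k4 k5 u =
     k1 + k2 * (ln u + 1) + 2 * k3 * u + k4 * u * (2 * ln u + 1) + 2 * k5 * u * ln u * (ln u + 1)"

lemma log_poly_has_derivative:
  assumes "0 < u"
  shows "(log_poly k0 k1 k2 k3 k4 k5 has_real_derivative log_poly_deriv k1 k2 k3 k4 k5 u) (at u)"
  unfolding log_poly_def[abs_def] log_poly_deriv_def
  by (rule derivative_eq_intros refl assms | use assms in \<open>simp add: field_simps power2_eq_square\<close>)+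

text \<open>Two rounds of the mean value theorem lead from six signs of \<open>D\<close> to five of
  \<open>D'\<close> and then to four alternating signs of a quadratic in \<open>ln u\<close>. Weak
  signs at \<open>t3\<close> and \<open>t4\<close> suffice, because the neighbouring values
  \<open>E s2\<close> and \<open>E s4\<close> are strictly negative.\<close>

lemma log_poly_deriv_sign_changes:
  assumes "0 < t1" "t1 < t2" "t2 < t3" "t3 < t4" "t4 < t5" "t5 < t6"
    and "D = log_poly_deriv k1 k2 k3 k4 k5"
    and "D t1 < 0" "0 < D t2" "D t3 \<le> 0" "0 \<le> D t4" "D t5 < 0" "0 < D t6"
  shows False
proof -
  \<comment> \<open>\<open>E u = u D' u\<close>, whose derivative is the quadratic polynomial \<open>q\<close> in \<open>ln u\<close>\<close>
  define E where "E u = k2 + u * (2 * k3 + k4 * (2 * ln u + 3) + k5 * (2 * (ln u)^2 + 6 * ln u + 2))" for u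
  define q where "q y = (2 * k3 + 5 * k4 + 8 * k5) + (2 * k4 + 10 * k5) * y + (2 * k5) * y^2" for y
  have D: "(D has_real_derivative E u / u) (at u)" if "0 < u" for u
    unfolding assms(7) log_poly_deriv_def[abs_def] E_def
    by (rule derivative_eq_intros refl that | use that in \<open>simp add: field_simps power2_eq_square\<close>)+
  have E: "(E has_real_derivative q (ln u)) (at u)" if "0 < u" for u
    unfolding E_def[abs_def] q_def
    by (rule derivative_eq_intros refl that | use that in \<open>simp add: field_simps power2_eq_square\<close>)+
  obtain s1 where s1: "t1 < s1" "s1 < t2" "0 < E s1"
    using MVT_deriv_pos[of t1 t2 D "\<lambda>u. E u / u"] D assms by (smt (verit) zero_less_divide_iff)
  obtain s2 where s2: "t2 < s2" "s2 < t3" "E s2 < 0"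
    using MVT_deriv_neg[of t2 t3 D "\<lambda>u. E u / u"] D assms by (smt (verit) divide_less_0_iff)
  obtain s3 where s3: "t3 < s3" "s3 < t4" "0 \<le> E s3"
    using MVT_deriv_nonneg[of t3 t4 D "\<lambda>u. E u / u"] D assms by (smt (verit) divide_neg_pos)
  obtain s4 where s4: "t4 < s4" "s4 < t5" "E s4 < 0"
    using MVT_deriv_neg[of t4 t5 D "\<lambda>u. E u / u"] D assms by (smt (verit) divide_less_0_iff)
  obtain s5 where s5: "t5 < s5" "s5 < t6" "0 < E s5"
    using MVT_deriv_pos[of t5 t6 D "\<lambda>u. E u / u"] D assms by (smt (verit) zero_less_divide_iff)
  obtain v1 where v1: "s1 < v1" "v1 < s2" "q (ln v1) < 0"
    using MVT_deriv_neg[of s1 s2 E "\<lambda>u. q (ln u)"] E assms s1 s2 by (smt (verit))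
  obtain v2 where v2: "s2 < v2" "v2 < s3" "0 < q (ln v2)"
    using MVT_deriv_pos[of s2 s3 E "\<lambda>u. q (ln u)"] E assms s1 s2 s3 by (smt (verit))
  obtain v3 where v3: "s3 < v3" "v3 < s4" "q (ln v3) < 0"
    using MVT_deriv_neg[of s3 s4 E "\<lambda>u. q (ln u)"] E assms s1 s2 s3 s4 by (smt (verit))
  obtain v4 where v4: "s4 < v4" "v4 < s5" "0 < q (ln v4)"
    using MVT_deriv_pos[of s4 s5 E "\<lambda>u. q (ln u)"] E assms s1 s2 s3 s4 s5 by (smt (verit))
  have "ln v1 < ln v2" "ln v2 < ln v3" "ln v3 < ln v4"
    using assms(1) v1 v2 v3 v4 s1 by simp_all
  then show False
    using quadratic_sign_changes[of "ln v1" "ln v2" "ln v3" "ln v4" "2 * k3 + 5 * k4 + 8 * k5" "2 * k4 + 10 * k5" "2 * k5"]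
      v1(3) v2(3) v3(3) v4(3) unfolding q_def by blast
qed

text \<open>The slopes at the ends make \<open>d\<close> negative just inside \<open>r\<close> and
  just inside \<open>1\<close>. Returning to a nonnegative value at \<open>b\<close> as well as to
  zero at \<open>a\<close> would give the derivative the sign pattern just excluded.\<close>

lemma log_poly_negative:
  fixes k0 k1 k2 k3 k4 k5 r a b :: real
  defines "d \<equiv> log_poly k0 k1 k2 k3 k4 k5" and "D \<equiv> log_poly_deriv k1 k2 k3 k4 k5"
  assumes "0 < r" "r < a" "a < 1" and "d r = 0" "d a = 0" "d 1 = 0"
    and "D r < 0" "D a = 0" "0 < D 1" and "r < b" "b < 1" "b \<noteq> a"
  shows "d b < 0"
proof (rule ccontr)
  assume "\<not> d b < 0"
  then have b: "0 \<le> d b" by simp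
  have dD: "(d has_real_derivative D u) (at u)" if "0 < u" for u
    unfolding d_def D_def using that by (rule log_poly_has_derivative)
  obtain e where e: "0 < e" "\<And>h. 0 < h \<Longrightarrow> h < e \<Longrightarrow> d (r + h) < 0"
    using DERIV_neg_dec_right[OF dD[of r]] assms by force
  obtain h where h: "0 < h" "h < e" "h < min a b - r"
    using field_lbound_gt_zero[of e "min a b - r"] e(1) assms by auto
  define m where "m = r + h"
  have m: "r < m" "m < a" "m < b" "d m < 0"
    using h e(2) by (auto simp: m_def)
  obtain e' where e': "0 < e'" "\<And>h. 0 < h \<Longrightarrow> h < e' \<Longrightarrow> d (1 - h) < 0"
    using DERIV_pos_inc_left[OF dD[of 1]] assms by force
  obtain h' where h': "0 < h'" "h' < e'" "h' < 1 - max a b"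
    using field_lbound_gt_zero[of e' "1 - max a b"] e'(1) assms by auto
  define n where "n = 1 - h'"
  have n: "n < 1" "a < n" "b < n" "d n < 0"
    using h' e'(2) by (auto simp: n_def)
  show False
  proof (cases "b < a")
    case True
    \<comment> \<open>The pattern is taken at \<open>r, s2, s3, a, s5, 1\<close>. The zero of
      \<open>D\<close> at \<open>a\<close> supplies the weak sign at the fourth point; when
      \<open>a < b\<close> it supplies the one at the third.\<close>
    obtain s2 where s2: "m < s2" "s2 < b" "0 < D s2"
      using MVT_deriv_pos[of m b d D] dD assms m b by (smt (verit))
    obtain s3 where s3: "b < s3" "s3 < a" "D s3 \<le> 0"
      using MVT_deriv_nonpos[of b a d D] dD assms True b by (smt (verit))
    obtain s5 where s5: "a < s5" "s5 < n" "D s5 < 0"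
      using MVT_deriv_neg[of a n d D] dD assms n by (smt (verit))
    show False
      using log_poly_deriv_sign_changes[of r s2 s3 a s5 1 D] assms m s2 s3 s5 n by force
  next
    case False
    obtain s2 where s2: "m < s2" "s2 < a" "0 < D s2"
      using MVT_deriv_pos[of m a d D] dD assms m b by (smt (verit))
    obtain s4 where s4: "a < s4" "s4 < b" "0 \<le> D s4"
      using MVT_deriv_nonneg[of a b d D] dD assms False b by (smt (verit))
    obtain s5 where s5: "b < s5" "s5 < n" "D s5 < 0"
      using MVT_deriv_neg[of b n d D] dD assms n b by (smt (verit))
    show False
      using log_poly_deriv_sign_changes[of r s2 a s4 s5 1 D] assms m s2 s4 s5 n by force
  qed
qed

section \<open>Inequality of means and bounds for Gram determinants\<close>

text \<open>Inequality of arithmetic and geometric means with its equality case, both read off from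
  writing \<open>s ^ 3 - 27 * (x * y * z)\<close> as a nonnegative combination of squares.\<close>

lemma prod3_le_of_sum_le_one:
  fixes x y z :: real
  assumes "0 \<le> x" "0 \<le> y" "0 \<le> z" "x + y + z \<le> 1"
  shows "x * y * z \<le> 1 / 27"
    and "1 / 27 \<le> x * y * z \<Longrightarrow> x = 1 / 3 \<and> y = 1 / 3 \<and> z = 1 / 3"
proof -
  define s where "s = x + y + z"
  define R where "R = (x - y)^2 + (y - z)^2 + (z - x)^2"
  define T where "T = x * (y - z)^2 + y * (z - x)^2 + z * (x - y)^2"
  have id: "s ^ 3 - 27 * (x * y * z) = s * R / 2 + 3 * T"
    unfolding s_def R_def T_def by (simp add: field_simps power3_eq_cube power2_eq_square)
  have s: "0 \<le> s" "s \<le> 1" and R: "0 \<le> R" and T: "0 \<le> T"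
    using assms by (simp_all add: s_def R_def T_def)
  have sR: "0 \<le> s * R" using s R by simp
  have s3: "s ^ 3 \<le> 1" using s by (simp add: power_le_one)
  show "x * y * z \<le> 1 / 27" using id sR T s3 by linarith
  assume ge: "1 / 27 \<le> x * y * z"
  then have "s ^ 3 = 1" "s * R = 0" using id sR T s3 by linarith+
  then have "s \<noteq> 0" and "s = 1" "R = 0"
    using s power_eq_1_iff[of s 3] by auto
  then have "x = y" "y = z" unfolding R_def by (smt (verit) zero_le_power2 power_eq_0_iff)+
  then show "x = 1 / 3 \<and> y = 1 / 3 \<and> z = 1 / 3" using \<open>s = 1\<close> by (simp add: s_def)
qed

lemma weighted_Cauchy_Schwarz:
  fixes v f g :: "'a \<Rightarrow> real"
  assumes "\<And>x. x \<in> S \<Longrightarrow> 0 \<le> v x"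
  shows "(\<Sum>x\<in>S. v x * (f x * g x))^2 \<le> (\<Sum>x\<in>S. v x * (f x * f x)) * (\<Sum>x\<in>S. v x * (g x * g x))"
proof -
  have v: "v x * (f x * g x) = (sqrt (v x) * f x) * (sqrt (v x) * g x)" if "x \<in> S" for x f g
    using assms[OF that] by (simp add: mult.left_commute mult.assoc flip: mult.assoc[of "sqrt _" "sqrt _"])
  show ?thesis
    using Cauchy_Schwarz_ineq_sum[of "\<lambda>x. sqrt (v x) * f x" "\<lambda>x. sqrt (v x) * g x" S]
    by (simp add: v power2_eq_square cong: sum.cong)
qed

text \<open>Gram matrix of the coordinate functions of \<open>p\<close> for the weight
  \<open>v\<close>. Keeping \<open>p\<close> arbitrary lets the Lagrange basis replace the
  gradient.\<close>

definition gram :: "'a set \<Rightarrow> ('a \<Rightarrow> real) \<Rightarrow> ('a \<Rightarrow> real ^ 3) \<Rightarrow> real ^ 3 ^ 3" where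
  "gram S v p = (\<Sum>x\<in>S. v x *\<^sub>R (\<chi> i j. p x $ i * p x $ j))"

lemma gram_nth: "gram S v p $ i $ j = (\<Sum>x\<in>S. v x * (p x $ i * p x $ j))"
  by (simp add: gram_def)

text \<open>Positive semidefiniteness and Hadamard's inequality in dimension three, both from
  Cauchy-Schwarz.\<close>

lemma det_gram_bounds:
  assumes v: "\<And>x. x \<in> S \<Longrightarrow> 0 \<le> v x"
  shows "0 \<le> det (gram S v p)"
    and "det (gram S v p) \<le> gram S v p $ 1 $ 1 * gram S v p $ 2 $ 2 * gram S v p $ 3 $ 3"
proof -
  define G where "G = gram S v p"
  define a b c x y z where abc: "a = G$1$1" "b = G$2$2" "c = G$3$3" "x = G$1$2" "y = G$1$3" "z = G$2$3"
  have sym: "G$i$j = G$j$i" for i j unfolding G_def gram_nth by (simp add: mult.commute)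
  have det: "det G = a * b * c + 2 * (x * y * z) - a * z^2 - b * y^2 - c * x^2"
    unfolding det_3 abc sym[of 2 1] sym[of 3 1] sym[of 3 2] by algebra
  have CS: "(G$i$j)^2 \<le> G$i$i * G$j$j" for i j
    unfolding G_def gram_nth by (rule weighted_Cauchy_Schwarz[OF v])
  have cs: "x^2 \<le> a * b" "y^2 \<le> a * c" "z^2 \<le> b * c" by (simp_all add: abc CS)
  have nn: "0 \<le> a" "0 \<le> b" "0 \<le> c"
    unfolding abc G_def gram_nth by (auto intro!: sum_nonneg mult_nonneg_nonneg[OF v])
  show "det (gram S v p) \<le> gram S v p $ 1 $ 1 * gram S v p $ 2 $ 2 * gram S v p $ 3 $ 3"
  proof -
    \<comment> \<open>With \<open>x\<close> bounded by Cauchy-Schwarz, the term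
      \<open>2 * (x * y * z)\<close> is dominated by the cross term in the square of
      \<open>sqrt a * \<bar>z\<bar> - sqrt b * \<bar>y\<bar>\<close>.\<close>
    have "\<bar>x\<bar> \<le> sqrt a * sqrt b"
      using real_sqrt_le_mono[OF cs(1)] by (simp add: real_sqrt_mult)
    then have "\<bar>x * y * z\<bar> \<le> (sqrt a * sqrt b) * \<bar>y * z\<bar>"
      using mult_right_mono[of "\<bar>x\<bar>" "sqrt a * sqrt b" "\<bar>y * z\<bar>"] by (simp add: abs_mult mult.assoc)
    also have "2 * \<dots> \<le> a * z^2 + b * y^2"
      using sum_squares_bound[of "sqrt a * \<bar>z\<bar>" "sqrt b * \<bar>y\<bar>"] nn
      by (simp add: power_mult_distrib abs_mult mult_ac)
    finally have "2 * (x * y * z) \<le> a * z^2 + b * y^2" by simp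
    moreover have "0 \<le> c * x^2" using nn by simp
    ultimately have "det G \<le> a * b * c" unfolding det by linarith
    then show ?thesis by (simp add: abc G_def)
  qed
  show "0 \<le> det (gram S v p)"
  proof (cases "a = 0")
    case True
    then have "x = 0" "y = 0" using cs by simp_all
    then have "det G = 0" unfolding det True by simp
    then show ?thesis by (simp add: G_def)
  next
    case False
    \<comment> \<open>Cauchy--Schwarz for the components orthogonal to the first row gives the Schur complement bound.\<close>
    define P where "P u = a * p u $ 2 - x * p u $ 1" for u
    define Q where "Q u = a * p u $ 3 - y * p u $ 1" for u
    have bil: "(\<Sum>u\<in>S. v u * ((m * p u $ i - n * p u $ j) * (m' * p u $ i' - n' * p u $ j')))
        = m * m' * G$i$i' - m * n' * G$i$j' - n * m' * G$j$i' + n * n' * G$j$j'" for m n m' n' i j i' j'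
      unfolding G_def gram_nth sum_distrib_left
      by (simp add: algebra_simps sum.distrib sum_subtractf)
    have "(a * (a * z - x * y))^2 \<le> (a * (a * b - x^2)) * (a * (a * c - y^2))"
      using weighted_Cauchy_Schwarz[of S v P Q, OF v]
      unfolding P_def Q_def bil by (simp add: abc sym[of 2 1] sym[of 3 1] sym[of 3 2] power2_eq_square algebra_simps)
    \<comment> \<open>The two sides of the preceding inequality differ by exactly this
      product.\<close>
    then have "0 \<le> a^2 * (a * det G)" unfolding det by (simp add: power2_eq_square algebra_simps)
    then have "0 \<le> det G" using False nn by (simp add: zero_le_mult_iff)
    then show ?thesis by (simp add: G_def)
  qed
qed

lemma gram_change_basis:
  assumes "\<And>x. x \<in> S \<Longrightarrow> f x = p x v* X"
  shows "gram S v f = transpose X ** gram S v p ** X"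
proof -
  have "gram S v f $ i $ j = (transpose X ** gram S v p ** X) $ i $ j" for i j
    using assms
    by (simp add: gram_nth matrix_matrix_mult_def transpose_def vector_matrix_mult_def sum_3
       sum_distrib_left algebra_simps sum.distrib cong: sum.cong)
  then show ?thesis by (simp add: vec_eq_iff)
qed

lemma fisher_info_gram:
  "fisher_info p0 p1 p2 \<xi> =
     gram (set_pmf \<xi>) (\<lambda>x. pmf \<xi> x * response_weight p0 p1 p2 x) (response_grad p0 p1 p2)"
  by (simp add: fisher_info_def gram_def)

section \<open>Convexity of \<open>u * ln u\<close> and Lagrange interpolation\<close>

text \<open>With \<open>t = u / v\<close>, the two sides differ by
  \<open>v * (t - 1 - ln t)\<close>, which is nonnegative and vanishes only at
  \<open>t = 1\<close>.\<close>

lemma xlnx_tangent: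
  fixes u v :: real
  assumes "0 < u" "0 < v"
  shows "u * ln u + (ln u + 1) * (v - u) \<le> v * ln v"
    and "u \<noteq> v \<Longrightarrow> u * ln u + (ln u + 1) * (v - u) < v * ln v"
proof -
  have eq: "v * ln v - (u * ln u + (ln u + 1) * (v - u)) = v * (u / v - 1 - ln (u / v))"
    using assms by (simp add: ln_div field_simps)
  have "ln (u / v) \<le> u / v - 1" using assms by (intro ln_le_minus_one) simp
  then show "u * ln u + (ln u + 1) * (v - u) \<le> v * ln v"
    using eq assms by (smt (verit) mult_nonneg_nonneg)
  assume "u \<noteq> v"
  then have "ln (u / v) \<noteq> u / v - 1" using assms ln_eq_minus_one[of "u / v"] by auto
  then have "ln (u / v) < u / v - 1" using \<open>ln (u / v) \<le> u / v - 1\<close> by simp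
  then show "u * ln u + (ln u + 1) * (v - u) < v * ln v"
    using eq assms by (smt (verit) mult_pos_pos)
qed

text \<open>The line through the points of \<open>u ln u\<close> at \<open>v\<close> and \<open>1\<close> is \<open>- chord v (1 - u)\<close>; note that
  \<open>chord r = - \<Delta>\<^sub>0\<close>.\<close>

definition chord :: "real \<Rightarrow> real" where
  "chord v = - (v * ln v / (1 - v))"

definition gap :: "real \<Rightarrow> real \<Rightarrow> real" where
  "gap v u = u * ln u + chord v * (1 - u)"

lemma gap_self [simp]: "v \<noteq> 1 \<Longrightarrow> gap v v = 0"
  by (simp add: gap_def chord_def)

lemma gap_1 [simp]: "gap v 1 = 0"
  by (simp add: gap_def)

lemma gap_swap: "u \<noteq> 1 \<Longrightarrow> gap v u = (1 - u) * (chord v - chord u)"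
  by (simp add: gap_def chord_def field_simps)

text \<open>\<open>chord v\<close> is the slope of the chord of \<open>u * ln u\<close> from
  \<open>v\<close> to \<open>1\<close>, and such slopes increase for a strictly convex
  function.\<close>

lemma chord_less:
  assumes "0 < r" "r < a" "a < 1"
  shows "chord r < chord a"
proof -
  have "a * ln a + (ln a + 1) * (r - a) < r * ln r"
    using xlnx_tangent(2)[of a r] assms by simp
  moreover have "a * ln a + (ln a + 1) * (1 - a) \<le> 0"
    using xlnx_tangent(1)[of a 1] assms by simp
  \<comment> \<open>The weights \<open>1 - a\<close> and \<open>a - r\<close> make the tangent slope
    \<open>ln a + 1\<close> cancel.\<close>
  ultimately have "(a * ln a + (ln a + 1) * (r - a)) * (1 - a) + (a * ln a + (ln a + 1) * (1 - a)) * (a - r)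
      < r * ln r * (1 - a) + 0 * (a - r)"
    using assms by (intro add_less_le_mono mult_strict_right_mono mult_right_mono) auto
  then have "a * ln a * (1 - r) < r * ln r * (1 - a)"
    by (simp add: algebra_simps)
  then show ?thesis
    using assms by (simp add: chord_def field_simps)
qed

lemma chord_less_one:
  assumes "0 < r" "r < 1"
  shows "chord r < 1"
  using xlnx_tangent(2)[of 1 r] assms by (simp add: chord_def field_simps)

lemma ln_less_chord:
  assumes "0 < r" "r < 1"
  shows "ln r + 1 < chord r"
proof -
  have "r * ln r + (ln r + 1) * (1 - r) < 0"
    using xlnx_tangent(2)[of r 1] assms by simp
  then show ?thesis
    using assms by (simp add: chord_def field_simps)
qed

text \<open>\<open>gap a\<close> vanishes at \<open>a\<close> and \<open>1\<close>,
  \<open>gap r\<close> at \<open>r\<close> and \<open>1\<close>. The denominators, and the minus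
  sign in \<open>l2\<close>, normalise them to one at the remaining node by
  \<open>gap_swap\<close>.\<close>

definition lagrange :: "real \<Rightarrow> real \<Rightarrow> real \<Rightarrow> real ^ 3" where
  "lagrange r a u =
    (let l1 = gap a u / ((1 - r) * (chord a - chord r)); l2 = - gap r u / ((1 - a) * (chord a - chord r))
     in vector [l1, l2, 1 - l1 - l2])"

lemma lagrange_nodes:
  assumes "0 < r" "r < a" "a < 1"
  shows "lagrange r a r = vector [1, 0, 0]" "lagrange r a a = vector [0, 1, 0]" "lagrange r a 1 = vector [0, 0, 1]"
proof -
  define D where "D = chord a - chord r"
  have "0 < D" "chord a = chord r + D" using chord_less[OF assms] by (simp_all add: D_def)
  then show "lagrange r a r = vector [1, 0, 0]" "lagrange r a a = vector [0, 1, 0]" "lagrange r a 1 = vector [0, 0, 1]"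
    using assms by (simp_all add: lagrange_def gap_swap[of r] gap_swap[of a])
qed

text \<open>Interpolation reproduces \<open>1\<close>, \<open>u\<close> and \<open>u * ln u\<close>
  exactly. The last identity has no third term because \<open>u * ln u\<close> vanishes at the node
  \<open>1\<close>.\<close>

lemma lagrange_interpolation:
  fixes u :: real
  assumes "0 < r" "r < a" "a < 1"
  defines "l \<equiv> lagrange r a u"
  shows "l $ 1 + l $ 2 + l $ 3 = 1" "l $ 1 * r + l $ 2 * a + l $ 3 = u"
    "l $ 1 * (r * ln r) + l $ 2 * (a * ln a) = u * ln u"
proof -
  define D where "D = chord a - chord r"
  have D: "D \<noteq> 0" "chord a = chord r + D" using chord_less[OF assms(1-3)] by (simp_all add: D_def)
  have r: "r * ln r = - chord r * (1 - r)" "a * ln a = - chord a * (1 - a)"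
    using assms by (simp_all add: chord_def field_simps)
  have l1: "l $ 1 * (1 - r) = gap a u / D"
   and l2: "l $ 2 * (1 - a) = - gap r u / D"
    using assms D by (simp_all add: l_def lagrange_def Let_def vector_3)
  show s: "l $ 1 + l $ 2 + l $ 3 = 1" by (simp add: l_def lagrange_def Let_def vector_3)
  have "l $ 1 * (1 - r) + l $ 2 * (1 - a) = 1 - u"
    unfolding l1 l2 using D by (simp add: gap_def field_simps)
  then show "l $ 1 * r + l $ 2 * a + l $ 3 = u"
    using s by (simp add: algebra_simps)
  have "l $ 1 * (r * ln r) + l $ 2 * (a * ln a) = - (l $ 1 * (1 - r)) * chord r - (l $ 2 * (1 - a)) * chord a"
    unfolding r by (simp add: algebra_simps)
  also have "\<dots> = u * ln u"
    unfolding l1 l2 using D by (simp add: gap_def field_simps)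
  finally show "l $ 1 * (r * ln r) + l $ 2 * (a * ln a) = u * ln u" .
qed

section \<open>The variance bound and the critical node\<close>

lemma log_poly_sum_squares:
  fixes m1 m2 m3 a1 a2 a3 b1 b2 b3 g1 g2 g3 n0 n1 n2 u :: real
  defines "k0 \<equiv> m1 * a1^2 + m2 * a2^2 + m3 * a3^2 - n0"
    and "k1 \<equiv> 2 * (m1 * a1 * b1 + m2 * a2 * b2 + m3 * a3 * b3) - n1"
    and "k2 \<equiv> 2 * (m1 * a1 * g1 + m2 * a2 * g2 + m3 * a3 * g3)"
    and "k3 \<equiv> m1 * b1^2 + m2 * b2^2 + m3 * b3^2 - n2"
    and "k4 \<equiv> 2 * (m1 * b1 * g1 + m2 * b2 * g2 + m3 * b3 * g3)"
    and "k5 \<equiv> m1 * g1^2 + m2 * g2^2 + m3 * g3^2"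
  shows "log_poly k0 k1 k2 k3 k4 k5 u =
      m1 * (a1 + b1 * u + g1 * (u * ln u))^2 + m2 * (a2 + b2 * u + g2 * (u * ln u))^2
      + m3 * (a3 + b3 * u + g3 * (u * ln u))^2 - (n0 + n1 * u + n2 * u^2)"
    and "log_poly_deriv k1 k2 k3 k4 k5 u =
      2 * (m1 * (a1 + b1 * u + g1 * (u * ln u)) * (b1 + g1 * (ln u + 1))
      + m2 * (a2 + b2 * u + g2 * (u * ln u)) * (b2 + g2 * (ln u + 1))
      + m3 * (a3 + b3 * u + g3 * (u * ln u)) * (b3 + g3 * (ln u + 1))) - (n1 + 2 * n2 * u)"
  unfolding log_poly_def log_poly_deriv_def assms by algebra+

text \<open>\<open>b\<close> stands for \<open>\<delta> * c\<close>. Since \<open>S - h\<close> is a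
  \<open>log_poly\<close> vanishing at the nodes, only its slopes at \<open>r\<close>,
  \<open>a\<close> and \<open>1\<close> need checking; \<open>critical\<close> makes the slope at
  \<open>a\<close> zero.\<close>

lemma lagrange_bound:
  fixes r a b c :: real
  defines "h \<equiv> \<lambda>u. (c - u) * (b + u)"
  defines "S \<equiv> \<lambda>u. h r * (lagrange r a u $ 1)^2 + h a * (lagrange r a u $ 2)^2 + h 1 * (lagrange r a u $ 3)^2"
  assumes ra: "0 < r" "r < a" "a < 1" and bc: "1 < c" "0 \<le> b"
    and critical: "2 * (ln a + 1 - chord r) * h a = gap r a * (c - b - 2 * a)"
    and u: "r < u" "u < 1" "u \<noteq> a"
  shows "S u < h u"
proof -
  define D where "D = chord a - chord r"
  define g where "g = 1 / D"
  have D: "0 < D" using chord_less[OF ra] by (simp add: D_def)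
  then have g: "0 < g" by (simp add: g_def)
  define g1 g2 g3 where gs: "g1 = g / (1 - r)" "g2 = - g / (1 - a)" "g3 = - g1 - g2"
  define a1 a2 a3 where as: "a1 = chord a * g1" "a2 = chord r * g2" "a3 = 1 - a1 - a2"
  define b1 b2 b3 where bs: "b1 = - a1" "b2 = - a2" "b3 = - b1 - b2"
  define l1 l2 l3 where ls: "l1 u = a1 + b1 * u + g1 * (u * ln u)" "l2 u = a2 + b2 * u + g2 * (u * ln u)"
     "l3 u = a3 + b3 * u + g3 * (u * ln u)" for u
  define l1' l2' l3' where ls': "l1' u = b1 + g1 * (ln u + 1)" "l2' u = b2 + g2 * (ln u + 1)"
     "l3' u = b3 + g3 * (ln u + 1)" for u
  have L12: "lagrange r a v $ 1 = l1 v" "lagrange r a v $ 2 = l2 v" for v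
  proof -
    have "l1 v = g1 * gap a v" "l2 v = g2 * gap r v"
      by (simp_all add: ls as bs gap_def algebra_simps)
    then show "lagrange r a v $ 1 = l1 v" "lagrange r a v $ 2 = l2 v"
      unfolding lagrange_def Let_def D_def[symmetric]
      by (simp_all add: vector_3 gs g_def mult.commute)
  qed
  have L3: "lagrange r a v $ 3 = l3 v" for v
    using lagrange_interpolation(1)[OF ra, of v] unfolding L12 by (simp add: ls gs as bs algebra_simps)
  have nodes: "l1 r = 1" "l2 r = 0" "l3 r = 0" "l1 a = 0" "l2 a = 1" "l3 a = 0" "l1 1 = 0" "l2 1 = 0" "l3 1 = 1"
    using lagrange_nodes[OF ra] by (simp_all flip: L12 L3 add: vector_3)
  have hv: "h v = c * b + (c - b) * v + (-1) * v^2" for v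
    by (simp add: h_def power2_eq_square algebra_simps)
  note eq1 = log_poly_sum_squares(1)[where ?m1.0 = "h r" and ?m2.0 = "h a" and ?m3.0 = "h 1"
    and ?a1.0 = a1 and ?a2.0 = a2 and ?a3.0 = a3 and ?b1.0 = b1 and ?b2.0 = b2 and ?b3.0 = b3
    and ?g1.0 = g1 and ?g2.0 = g2 and ?g3.0 = g3 and ?n0.0 = "c * b" and ?n1.0 = "c - b" and ?n2.0 = "-1",
    folded ls hv]
  note eq2 = log_poly_sum_squares(2)[where ?m1.0 = "h r" and ?m2.0 = "h a" and ?m3.0 = "h 1"
    and ?a1.0 = a1 and ?a2.0 = a2 and ?a3.0 = a3 and ?b1.0 = b1 and ?b2.0 = b2 and ?b3.0 = b3
    and ?g1.0 = g1 and ?g2.0 = g2 and ?g3.0 = g3 and ?n1.0 = "c - b" and ?n2.0 = "-1",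
    folded ls ls']
  obtain k0 k1 k2 k3 k4 k5 where k:
     "\<And>v. log_poly k0 k1 k2 k3 k4 k5 v = h r * (l1 v)^2 + h a * (l2 v)^2 + h 1 * (l3 v)^2 - h v"
     "\<And>v. log_poly_deriv k1 k2 k3 k4 k5 v = 2 * (h r * l1 v * l1' v + h a * l2 v * l2' v + h 1 * l3 v * l3' v) - (c - b + 2 * (-1) * v)"
    by (rule that[OF eq1 eq2])
  let ?d = "log_poly k0 k1 k2 k3 k4 k5" and ?D = "log_poly_deriv k1 k2 k3 k4 k5"
  \<comment> \<open>Nonnegative coefficients of \<open>u * ln u\<close> make \<open>l1\<close> and
    \<open>l3\<close> convex. Their tangents at \<open>r\<close> and \<open>1\<close>, compared with
    the value zero at \<open>a\<close>, control \<open>l1' r\<close> and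
    \<open>l3' 1\<close>.\<close>
  have g1: "0 \<le> g1" and g3: "0 \<le> g3"
    using g ra by (simp_all add: gs divide_left_mono)
  have tangent: "0 \<le> \<gamma> \<Longrightarrow> 0 < v \<Longrightarrow> 0 < w \<Longrightarrow>
      (\<alpha> + \<beta> * v + \<gamma> * (v * ln v)) + (\<beta> + \<gamma> * (ln v + 1)) * (w - v) \<le> \<alpha> + \<beta> * w + \<gamma> * (w * ln w)" for \<alpha> \<beta> \<gamma> v w :: real
    using mult_left_mono[OF xlnx_tangent(1)[of v w], of \<gamma>] by (simp add: algebra_simps)
  have "?D r < 0"
  proof -
    have hr: "0 < (c - r) * (b + r)" using ra bc by simp
    have "1 + l1' r * (a - r) \<le> 0"
      using tangent[OF g1, of r a a1 b1] ra nodes by (simp add: ls ls')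
    then have "h r * (1 + l1' r * (a - r)) \<le> 0"
      using hr by (intro mult_nonneg_nonpos) (simp_all add: h_def)
    then have "h r / (a - r) \<le> - (h r * l1' r)"
      using ra by (simp add: pos_divide_le_eq algebra_simps)
    \<comment> \<open>This uses \<open>a < c\<close>. Altogether
      \<open>?D r < - 2 * (b + r) - (c - b - 2 * r) = - (b + c) < 0\<close>.\<close>
    moreover have "b + r < h r / (a - r)"
      using ra bc mult_strict_right_mono[of "a - r" "c - r" "b + r"] by (simp add: h_def pos_less_divide_eq mult.commute)
    ultimately show ?thesis using nodes ra bc by (simp add: k)
  qed
  moreover have "0 < ?D 1"
  proof -
    have h1: "0 < h 1" using bc by (simp add: h_def)
    have "1 - l3' 1 * (1 - a) \<le> 0"
      using tangent[OF g3, of 1 a a3 b3] ra nodes by (simp add: ls ls' algebra_simps)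
    then have "1 < l3' 1"
      using ra by (smt (verit) mult_less_cancel_left2 mult_nonpos_nonneg mult_left_le)
    then have "h 1 < h 1 * l3' 1" using h1 by simp
    \<comment> \<open>Hence \<open>?D 1 > 2 * (c - 1) - (c - b - 2) = c + b > 0\<close>.\<close>
    moreover have "c - 1 \<le> h 1" using bc mult_left_mono[of 1 "b + 1" "c - 1"] by (simp add: h_def)
    ultimately have "c - b - 2 < 2 * (h 1 * l3' 1)" using bc by linarith
    then show ?thesis using nodes by (simp add: k)
  qed
  moreover have "?D a = 0"
  proof -
    \<comment> \<open>\<open>gap r a\<close> is the reciprocal of \<open>g2\<close>, so multiplying
      \<open>critical\<close> by \<open>g2\<close> gives
      \<open>2 * h a * l2' a = c - b - 2 * a\<close>.\<close>
    have ga: "gap r a = - (1 - a) / g"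
      using gap_swap[of a r] ra by (simp add: g_def D_def algebra_simps)
    have "l2' a = g2 * (ln a + 1 - chord r)" by (simp add: ls' bs as algebra_simps)
    then have "2 * h a * l2' a = g2 * (2 * (ln a + 1 - chord r) * h a)" by simp
    also have "\<dots> = (g2 * gap r a) * (c - b - 2 * a)"
      unfolding critical by simp
    also have "g2 * gap r a = 1"
      using g ra by (simp add: ga gs field_simps)
    finally show ?thesis using nodes by (simp add: k algebra_simps)
  qed
  ultimately have "?d u < 0"
    using ra u nodes by (intro log_poly_negative[of r a]) (simp_all add: k)
  then show ?thesis by (simp add: k S_def L12 L3)
qed

text \<open>The chord slope of \<open>u * ln u\<close> lies strictly between the tangent slopes
  \<open>ln r + 1\<close> and \<open>1\<close>, so \<open>W\<close> has opposite signs at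
  \<open>r\<close> and \<open>1\<close>.\<close>

lemma critical_point_exists:
  fixes r b c :: real
  assumes "0 < r" "r < 1" "1 < c" "0 \<le> b"
  obtains a where "r < a" "a < 1"
    "2 * (ln a + 1 - chord r) * ((c - a) * (b + a)) = gap r a * (c - b - 2 * a)"
proof -
  define W where "W u = 2 * (ln u + 1 - chord r) * ((c - u) * (b + u)) - gap r u * (c - b - 2 * u)" for u
  have "W r < 0" "0 < W 1"
    using assms ln_less_chord[OF assms(1,2)] chord_less_one[OF assms(1,2)]
    by (simp_all add: W_def mult_pos_pos mult_neg_pos)
  moreover have "continuous_on {r..1} W"
    unfolding W_def gap_def using assms by (intro continuous_intros) auto
  ultimately obtain a where "r \<le> a" "a \<le> 1" "W a = 0"
    using IVT'[of W r 0 1] assms by force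
  moreover from this have "a \<noteq> r" "a \<noteq> 1" using \<open>W r < 0\<close> \<open>0 < W 1\<close> by auto
  ultimately show ?thesis by (intro that[of a]) (auto simp: W_def)
qed

section \<open>A criterion for D-optimality of a uniform three-point design\<close>

lemma D_optimal_iff_uniform:
  fixes p0 p1 p2 z1 z2 z3 :: real and l :: "real \<Rightarrow> real ^ 3"
  defines "f \<equiv> response_grad p0 p1 p2" and "lam \<equiv> response_weight p0 p1 p2"
  defines "X \<equiv> vector [f z1, f z2, f z3] :: real ^ 3 ^ 3"
  defines "S \<equiv> \<lambda>x. (l x $ 1)^2 / lam z1 + (l x $ 2)^2 / lam z2 + (l x $ 3)^2 / lam z3"
  assumes nodes: "{z1, z2, z3} \<subseteq> {xL..xU}" and dist: "z1 \<noteq> z2" "z1 \<noteq> z3" "z2 \<noteq> z3"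
    and pos: "\<And>x. x \<in> {xL..xU} \<Longrightarrow> 0 < lam x"
    and interp: "\<And>x. x \<in> {xL..xU} \<Longrightarrow> f x = l x v* X"
    and l: "l z1 = vector [1, 0, 0]" "l z2 = vector [0, 1, 0]" "l z3 = vector [0, 0, 1]"
    and det: "det X \<noteq> 0"
    and bound: "\<And>x. x \<in> {xL..xU} \<Longrightarrow> x \<notin> {z1, z2, z3} \<Longrightarrow> lam x * S x < 1"
  shows "D_optimal p0 p1 p2 xL xU \<xi> \<longleftrightarrow> \<xi> = pmf_of_set {z1, z2, z3}"
proof -
  define N where "N \<eta> = gram (set_pmf \<eta>) (\<lambda>x. pmf \<eta> x * lam x) l" for \<eta> :: "real pmf"
  \<comment> \<open>Dividing by \<open>lam z\<close> makes the three entries equal to the weights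
    when the design lives on the nodes; in general they sum to at most one.\<close>
  define E where "E \<eta> i z = N \<eta> $ i $ i / lam z" for \<eta> :: "real pmf" and i :: 3 and z
  define \<Lambda> where "\<Lambda> = lam z1 * lam z2 * lam z3"
  define U where "U = pmf_of_set {z1, z2, z3}"
  have lamz: "0 < lam z1" "0 < lam z2" "0 < lam z3" using nodes pos by auto
  then have \<Lambda>: "0 < \<Lambda>" by (simp add: \<Lambda>_def)
  have bound1: "lam z * S z = 1" if "z \<in> {z1, z2, z3}" for z
    using that l lamz by (auto simp: S_def vector_3)
  have bound': "lam x * S x \<le> 1" if "x \<in> {xL..xU}" for x
    using bound[OF that] bound1[of x] by fastforce
  have detM: "det (fisher_info p0 p1 p2 \<eta>) = (det X)^2 * det (N \<eta>)" if "\<eta> \<in> designs xL xU" for \<eta>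
  proof -
    have "fisher_info p0 p1 p2 \<eta> = transpose X ** N \<eta> ** X"
      unfolding fisher_info_gram N_def lam_def[symmetric] f_def[symmetric]
      using that interp by (intro gram_change_basis) (auto simp: designs_def)
    then show ?thesis by (simp add: det_mul det_transpose power2_eq_square)
  qed
  have wpos: "0 \<le> pmf \<eta> x * lam x" if "\<eta> \<in> designs xL xU" "x \<in> set_pmf \<eta>" for \<eta> x
    using that pos[of x] by (auto simp: designs_def intro!: mult_nonneg_nonneg intro: less_imp_le)
  have E_nonneg: "0 \<le> E \<eta> i z" if "\<eta> \<in> designs xL xU" "z \<in> {z1, z2, z3}" for \<eta> i z
    using that lamz wpos[OF that(1)] unfolding E_def N_def gram_nth
    by (intro divide_nonneg_nonneg sum_nonneg mult_nonneg_nonneg[of "_ * _"]) (auto simp: less_imp_le)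
  have E_sum: "E \<eta> 1 z1 + E \<eta> 2 z2 + E \<eta> 3 z3 = (\<Sum>x\<in>set_pmf \<eta>. pmf \<eta> x * (lam x * S x))" for \<eta>
    unfolding E_def N_def gram_nth S_def
    by (simp add: sum_divide_distrib power2_eq_square distrib_left mult.assoc flip: sum.distrib)
  have sum1: "(\<Sum>x\<in>set_pmf \<eta>. pmf \<eta> x) = 1" if "\<eta> \<in> designs xL xU" for \<eta>
    using that by (intro sum_pmf_eq_1) (auto simp: designs_def)
  have E_le: "E \<eta> 1 z1 + E \<eta> 2 z2 + E \<eta> 3 z3 \<le> 1" if "\<eta> \<in> designs xL xU" for \<eta>
  proof -
    have "(\<Sum>x\<in>set_pmf \<eta>. pmf \<eta> x * (lam x * S x)) \<le> (\<Sum>x\<in>set_pmf \<eta>. pmf \<eta> x * 1)"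
      using that bound' by (intro sum_mono mult_left_mono) (auto simp: designs_def)
    then show ?thesis using E_sum sum1[OF that] by simp
  qed
  have detN: "0 \<le> det (N \<eta>)" "det (N \<eta>) \<le> \<Lambda> * (E \<eta> 1 z1 * E \<eta> 2 z2 * E \<eta> 3 z3)" if "\<eta> \<in> designs xL xU" for \<eta>
    using det_gram_bounds[of "set_pmf \<eta>" "\<lambda>x. pmf \<eta> x * lam x" l, OF wpos[OF that]] lamz
    by (simp_all add: N_def E_def \<Lambda>_def)
  have U: "set_pmf U = {z1, z2, z3}" "pmf U z = indicator {z1, z2, z3} z / 3" for z
    using dist by (simp_all add: U_def)
  have Ud: "U \<in> designs xL xU" using nodes by (simp add: designs_def U)
  have "det (N U) = \<Lambda> / 27"
    using dist by (simp add: N_def det_3 gram_nth U l vector_3 \<Lambda>_def)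
  then have detU: "det (fisher_info p0 p1 p2 U) = (det X)^2 * (\<Lambda> / 27)"
    using detM[OF Ud] by simp
  then have posU: "0 < det (fisher_info p0 p1 p2 U)" unfolding detU using det \<Lambda> by simp
  \<comment> \<open>Positivity lets comparisons pass between \<open>ln\<close> of determinants and
    the determinants themselves.\<close>
  have pos_est: "0 < det (fisher_info p0 p1 p2 \<eta>)" if "\<eta> \<in> designs xL xU" "estimable p0 p1 p2 \<eta>" for \<eta>
    using that detM[OF that(1)] detN(1)[OF that(1)] det
    by (simp add: estimable_def invertible_det_nz order_less_le)
  have "D_optimal p0 p1 p2 xL xU U"
    unfolding D_optimal_def
  proof (intro conjI ballI impI)
    show "estimable p0 p1 p2 U" using posU by (simp add: estimable_def invertible_det_nz)
    fix \<eta> assume \<eta>: "\<eta> \<in> designs xL xU" "estimable p0 p1 p2 \<eta>"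
    have "E \<eta> 1 z1 * E \<eta> 2 z2 * E \<eta> 3 z3 \<le> 1 / 27"
      using E_nonneg[OF \<eta>(1)] E_le[OF \<eta>(1)] by (intro prod3_le_of_sum_le_one) auto
    then have "\<Lambda> * (E \<eta> 1 z1 * E \<eta> 2 z2 * E \<eta> 3 z3) \<le> \<Lambda> * (1 / 27)"
      using \<Lambda> by (intro mult_left_mono) auto
    then have "det (N \<eta>) \<le> \<Lambda> / 27" using detN(2)[OF \<eta>(1)] by simp
    then have "det (fisher_info p0 p1 p2 \<eta>) \<le> det (fisher_info p0 p1 p2 U)"
      unfolding detM[OF \<eta>(1)] detU by (intro mult_left_mono) auto
    then show "ln (det (fisher_info p0 p1 p2 \<eta>)) \<le> ln (det (fisher_info p0 p1 p2 U))"
      using pos_est[OF \<eta>] posU by simp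
  qed (rule Ud)
  moreover have "\<xi> = U" if opt: "D_optimal p0 p1 p2 xL xU \<xi>"
  proof -
    have \<xi>: "\<xi> \<in> designs xL xU" "estimable p0 p1 p2 \<xi>"
      and "ln (det (fisher_info p0 p1 p2 U)) \<le> ln (det (fisher_info p0 p1 p2 \<xi>))"
      using opt \<open>D_optimal p0 p1 p2 xL xU U\<close> by (auto simp: D_optimal_def)
    then have "det (fisher_info p0 p1 p2 U) \<le> det (fisher_info p0 p1 p2 \<xi>)"
      using pos_est[OF \<xi>] posU by simp
    then have "\<Lambda> / 27 \<le> det (N \<xi>)" unfolding detU detM[OF \<xi>(1)] using det by simp
    then have "\<Lambda> * (1 / 27) \<le> \<Lambda> * (E \<xi> 1 z1 * E \<xi> 2 z2 * E \<xi> 3 z3)"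
      using detN(2)[OF \<xi>(1)] by simp
    then have "1 / 27 \<le> E \<xi> 1 z1 * E \<xi> 2 z2 * E \<xi> 3 z3" using \<Lambda> mult_le_cancel_left_pos by blast
    then have E: "E \<xi> 1 z1 = 1 / 3 \<and> E \<xi> 2 z2 = 1 / 3 \<and> E \<xi> 3 z3 = 1 / 3"
      using E_nonneg[OF \<xi>(1)] E_le[OF \<xi>(1)] by (intro prod3_le_of_sum_le_one) auto
    have fin: "finite (set_pmf \<xi>)" and sub: "set_pmf \<xi> \<subseteq> {xL..xU}" using \<xi>(1) by (auto simp: designs_def)
    \<comment> \<open>The entries \<open>E\<close> sum to one, so the nonnegative slack averages to
      zero and vanishes on the support; strictness of \<open>bound\<close> then leaves only the
      nodes.\<close>
    have "(\<Sum>x\<in>set_pmf \<xi>. pmf \<xi> x * (1 - lam x * S x)) = 0"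
      using E_sum[of \<xi>] E sum1[OF \<xi>(1)] by (simp add: right_diff_distrib sum_subtractf)
    then have z: "pmf \<xi> x * (1 - lam x * S x) = 0" if "x \<in> set_pmf \<xi>" for x
      using that fin sub bound' by (subst (asm) sum_nonneg_eq_0_iff) auto
    have supp: "set_pmf \<xi> \<subseteq> {z1, z2, z3}"
    proof
      fix x assume x: "x \<in> set_pmf \<xi>"
      then have "lam x * S x = 1" using z[OF x] by (simp add: set_pmf_eq)
      then show "x \<in> {z1, z2, z3}" using bound[of x] x sub by force
    qed
    have "N \<xi> $ i $ i = (\<Sum>x\<in>{z1, z2, z3}. pmf \<xi> x * lam x * (l x $ i * l x $ i))" for i
      unfolding N_def gram_nth using supp
      by (intro sum.mono_neutral_left) (auto simp: set_pmf_eq)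
    then have "E \<xi> 1 z1 = pmf \<xi> z1" "E \<xi> 2 z2 = pmf \<xi> z2" "E \<xi> 3 z3 = pmf \<xi> z3"
      using dist lamz by (simp_all add: E_def l vector_3)
    then have "pmf \<xi> x = pmf U x" for x
      using E supp by (cases "x \<in> {z1, z2, z3}") (auto simp: U set_pmf_eq)
    then show ?thesis by (rule pmf_eqI)
  qed
  ultimately show ?thesis by (auto simp: U_def)
qed

section \<open>The group testing model in the variable \<open>u\<close>\<close>

text \<open>Since \<open>x - xL = ln u / ln (1 - p0)\<close>, the factor \<open>x\<close> becomes
  \<open>ln u\<close>, and the gradient is a fixed linear image of
  \<open>(1, u, u ln u)\<close>.\<close>

lemma response_grad_relative:
  fixes p0 p1 p2 xL x :: real
  defines "\<gamma> \<equiv> (1 - p0) powr xL" and "u \<equiv> (1 - p0) powr (x - xL)"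
  defines "\<beta> \<equiv> (p1 + p2 - 1) * \<gamma> / (1 - p0)"
  assumes "0 < p0" "p0 < 1"
  shows "response_grad p0 p1 p2 x =
    vector [\<beta> * (xL * u + u * ln u / ln (1 - p0)), 1 - \<gamma> * u, - (\<gamma> * u)]"
proof -
  have "u * ln u / ln (1 - p0) = (x - xL) * u"
    using assms by (simp add: u_def ln_powr)
  moreover have "(1 - p0) powr x = \<gamma> * u" "(1 - p0) powr (x - 1) = \<gamma> * u / (1 - p0)"
    using assms by (simp_all add: u_def \<gamma>_def powr_diff)
  ultimately show ?thesis
    by (simp add: response_grad_def \<beta>_def algebra_simps flip: diff_divide_distrib)
qed

context
  fixes p0 p1 p2 xL xU :: real
  assumes p0: "0 < p0" "p0 < 1" and p1: "1 / 2 < p1" "p1 \<le> 1" and p2: "1 / 2 < p2" "p2 \<le> 1"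
    and xL: "1 \<le> xL" and xLU: "xL < xU"
begin

private abbreviation "c \<equiv> const_c p0 p1 p2 xL"
private abbreviation "b \<equiv> const_delta p1 * const_c p0 p1 p2 xL"
private abbreviation "r \<equiv> const_r p0 xL xU"
private abbreviation "\<sigma> \<equiv> (p1 + p2 - 1) * (1 - p0) powr xL"
private abbreviation "u \<equiv> \<lambda>x. (1 - p0) powr (x - xL)"
private abbreviation "h \<equiv> \<lambda>v. (c - v) * (b + v)"

lemma sigma_pos: "0 < \<sigma>"
  using p0 p1 p2 by simp

lemma const_c_gt_1: "1 < c"
proof -
  have "(1 - p0) powr xL < 1" using powr_less_mono'[of "1 - p0" 0 xL] p0 xL by simp
  then have "\<sigma> < (p1 + p2 - 1) * 1" using p1 p2 by (intro mult_strict_left_mono) auto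
  also have "\<dots> \<le> p1" using p2 by simp
  finally have "\<sigma> < p1" .
  then show ?thesis using sigma_pos by (simp add: const_c_def)
qed

lemma const_delta_c_nonneg: "0 \<le> b"
  using const_c_gt_1 p1 by (intro mult_nonneg_nonneg) (simp_all add: const_delta_def)

lemma const_r_bounds: "0 < r" "r < 1"
  using powr_less_mono'[of "1 - p0" 0 "xU - xL"] p0 xLU by (simp_all add: const_r_def)

text \<open>From \<open>\<sigma> * c = p1\<close> and \<open>\<sigma> * b = 1 - p1\<close>, the two
  response probabilities factor as \<open>\<sigma> * (c - u x)\<close> and
  \<open>\<sigma> * (b + u x)\<close>.\<close>

lemma response_weight_relative: "response_weight p0 p1 p2 x = 1 / (\<sigma>^2 * h (u x))"
proof -
  have "\<sigma> \<noteq> 0" by (rule less_imp_neq[OF sigma_pos, symmetric])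
  then have "\<sigma> * c = p1"
    by (simp only: const_c_def times_divide_eq_right nonzero_mult_div_cancel_left not_False_eq_True)
  then have "\<sigma> * c = p1" "\<sigma> * b = 1 - p1"
    using p1 by (simp_all add: const_delta_def mult.left_commute[of \<sigma>])
  moreover have "(1 - p0) powr x = (1 - p0) powr xL * u x"
    by (simp flip: powr_add)
  ultimately have "response_prob p0 p1 p2 x = \<sigma> * (c - u x)" "1 - response_prob p0 p1 p2 x = \<sigma> * (b + u x)"
    by (simp_all add: response_prob_def algebra_simps)
  then show ?thesis
    unfolding response_weight_def by (simp add: power2_eq_square mult_ac inverse_eq_divide)
qed

text \<open>The logarithmic denominator is \<open>gap r a / a\<close>, nonzero by strict
  monotonicity of \<open>chord\<close>, so all denominators can be cleared.\<close>

lemma A1_root_iff_critical: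
  "A1_root p0 p1 p2 xL xU a \<longleftrightarrow>
     r < a \<and> a < 1 \<and> 2 * (ln a + 1 - chord r) * h a = gap r a * (c - b - 2 * a)"
proof (cases "r < a \<and> a < 1")
  case True
  define G where "G = gap r a"
  have "0 < a" using True const_r_bounds by simp
  have G: "G \<noteq> 0"
    using gap_swap[of a r] chord_less[OF const_r_bounds(1), of a] True by (simp add: G_def)
  have chord: "const_Delta0 p0 xL xU = - chord r"
    by (simp add: const_Delta0_def chord_def)
  have "ln a - const_Delta0 p0 xL xU * (1 / a - 1) = G / a"
    using \<open>0 < a\<close> by (simp add: chord G_def gap_def field_simps)
  then have "2 / a * (1 + (1 + const_Delta0 p0 xL xU * (1 / a)) / (ln a - const_Delta0 p0 xL xU * (1 / a - 1)))
      = 2 / a * ((G + a - chord r) / G)"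
    using \<open>0 < a\<close> G by (simp add: chord field_simps)
  also have "G + a - chord r = a * (ln a + 1 - chord r)"
    by (simp add: G_def gap_def algebra_simps)
  finally have lhs: "2 / a * (1 + (1 + const_Delta0 p0 xL xU * (1 / a)) / (ln a - const_Delta0 p0 xL xU * (1 / a - 1)))
      = 2 * (ln a + 1 - chord r) / G"
    using \<open>0 < a\<close> by simp
  have pos: "0 < c - a" "0 < b + a" using True \<open>0 < a\<close> const_c_gt_1 const_delta_c_nonneg by auto
  then have rhs: "1 / (b + a) - 1 / (c - a) = (c - b - 2 * a) / h a"
    by (simp add: diff_frac_eq mult.commute)
  have "A1_root p0 p1 p2 xL xU a \<longleftrightarrow> 2 * (ln a + 1 - chord r) / G = (c - b - 2 * a) / h a"
    unfolding A1_root_def Let_def lhs rhs using True by simp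
  also have "\<dots> \<longleftrightarrow> 2 * (ln a + 1 - chord r) * h a = (c - b - 2 * a) * G"
    using G pos by (intro frac_eq_eq) simp_all
  finally show ?thesis
    using True by (simp add: G_def mult.commute)
qed (auto simp: A1_root_def Let_def)

text \<open>As \<open>u\<close> is decreasing, the nodes \<open>r\<close>, \<open>a\<close>,
  \<open>1\<close> correspond to \<open>xU\<close>, \<open>x2\<close>, \<open>xL\<close> in this
  order. Any root \<open>a\<close> determines the optimal design, which later yields uniqueness of
  the root.\<close>

lemma D_optimal_iff_A1_root:
  assumes root: "A1_root p0 p1 p2 xL xU a"
  defines "x2 \<equiv> xL + ln a / ln (1 - p0)"
  shows "xL < x2" "x2 < xU" "D_optimal p0 p1 p2 xL xU \<xi> \<longleftrightarrow> \<xi> = pmf_of_set {xU, x2, xL}"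
proof -
  have a: "r < a" "a < 1" and critical: "2 * (ln a + 1 - chord r) * h a = gap r a * (c - b - 2 * a)"
    using root A1_root_iff_critical by auto
  have a0: "0 < a" using a const_r_bounds by simp
  have lq: "ln (1 - p0) < 0" using p0 by simp
  have "ln r < ln a" using a const_r_bounds by simp
  then have "(xU - xL) * ln (1 - p0) < ln a" using p0 by (simp add: const_r_def ln_powr)
  then have "ln a / ln (1 - p0) < xU - xL" using lq by (simp add: neg_divide_less_eq)
  then show x2: "xL < x2" "x2 < xU"
    using a a0 lq by (auto simp: x2_def divide_neg_neg)
  have ux2: "u x2 = a" using a0 lq p0 by (simp add: x2_def powr_def)
  have uxL: "u xL = 1" and uxU: "u xU = r" using p0 by (simp_all add: const_r_def)
  have mono: "u x < u y \<longleftrightarrow> y < x" for x y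
    using powr_less_mono'[of "1 - p0" "x - xL" "y - xL"] powr_less_mono'[of "1 - p0" "y - xL" "x - xL"] p0
    by (cases x y rule: linorder_cases) auto
  have hpos: "0 < h v" if "r \<le> v" "v \<le> 1" for v
    using that const_r_bounds const_c_gt_1 const_delta_c_nonneg by (intro mult_pos_pos) auto
  note ra = const_r_bounds(1) a
  let ?l = "\<lambda>x. lagrange r a (u x)"
  let ?X = "vector [response_grad p0 p1 p2 xU, response_grad p0 p1 p2 x2, response_grad p0 p1 p2 xL] :: real ^ 3 ^ 3"
  have ubounds: "r \<le> u x" "u x \<le> 1" if "x \<in> {xL..xU}" for x
  proof -
    have "\<not> u x < u xU" "\<not> u xL < u x" unfolding mono using that by auto
    then show "r \<le> u x" "u x \<le> 1" unfolding uxL uxU by simp_all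
  qed
  have weight_pos: "0 < response_weight p0 p1 p2 x" if "x \<in> {xL..xU}" for x
    unfolding response_weight_relative
    by (rule divide_pos_pos[OF zero_less_one mult_pos_pos[OF zero_less_power[OF sigma_pos] hpos[OF ubounds[OF that]]]])
  show "D_optimal p0 p1 p2 xL xU \<xi> \<longleftrightarrow> \<xi> = pmf_of_set {xU, x2, xL}"
  proof (rule D_optimal_iff_uniform[where l = ?l])
    define \<gamma> \<beta> k where coeffs: "\<gamma> = (1 - p0) powr xL" "\<beta> = (p1 + p2 - 1) * \<gamma> / (1 - p0)" "k = ln (1 - p0)"
    have "0 < \<gamma>" "0 < \<beta>" "k < 0" using p0 p1 p2 lq by (simp_all add: coeffs)
    have grad: "response_grad p0 p1 p2 x =
        vector [\<beta> * (xL * u x + u x * ln (u x) / k), 1 - \<gamma> * u x, - (\<gamma> * u x)]" for x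
      unfolding coeffs by (rule response_grad_relative[OF p0])
    show "response_grad p0 p1 p2 x = ?l x v* ?X" if "x \<in> {xL..xU}" for x
    proof -
      define v where "v = u x"
      define l1 l2 l3 where ls: "l1 = lagrange r a v $ 1" "l2 = lagrange r a v $ 2" "l3 = lagrange r a v $ 3"
      have int: "l1 + l2 + l3 = 1" "v = l1 * r + l2 * a + l3" "v * ln v = l1 * (r * ln r) + l2 * (a * ln a)"
        unfolding ls by (rule lagrange_interpolation[OF ra, symmetric] lagrange_interpolation[OF ra])+
      have "\<beta> * (xL * v + v * ln v / k) = l1 * (\<beta> * (xL * r + r * ln r / k))
          + l2 * (\<beta> * (xL * a + a * ln a / k)) + l3 * (\<beta> * xL)"
        unfolding int(3) by (subst int(2)) (simp add: algebra_simps add_divide_distrib)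
      moreover have "1 - \<gamma> * v = l1 * (1 - \<gamma> * r) + l2 * (1 - \<gamma> * a) + l3 * (1 - \<gamma>)"
        using int(1) by (subst int(2)) (simp add: algebra_simps)
      moreover have "- (\<gamma> * v) = l1 * - (\<gamma> * r) + l2 * - (\<gamma> * a) + l3 * - \<gamma>"
        by (subst int(2)) (simp add: algebra_simps)
      ultimately show ?thesis
        unfolding grad uxL uxU ux2 v_def[symmetric]
        by (simp add: vec_eq_iff forall_3 vector_matrix_mult_def sum_3 vector_3 ls[symmetric] mult.commute)
    qed
    define e where "e = \<beta> / k"
    have e: "\<beta> * (xL * v + w / k) = \<beta> * xL * v + e * w" for v w
      by (simp add: e_def algebra_simps)
    have "det ?X = - \<gamma> * e * (r * ln r * (1 - a) - a * ln a * (1 - r))"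
      unfolding grad uxL uxU ux2 e by (simp add: det_3 vector_3 algebra_simps)
    \<comment> \<open>Up to a nonzero factor, \<open>det ?X\<close> is the determinant of
      \<open>(1, u, u ln u)\<close> at the nodes, which is nonzero because the two chord slopes
      differ.\<close>
    also have "r * ln r * (1 - a) - a * ln a * (1 - r) = (1 - r) * (1 - a) * (chord a - chord r)"
    proof -
      have "(1 - r) * chord r = - (r * ln r)" "(1 - a) * chord a = - (a * ln a)"
        using a const_r_bounds by (simp_all add: chord_def)
      then show ?thesis by algebra
    qed
    finally show "det ?X \<noteq> 0"
      using \<open>0 < \<gamma>\<close> \<open>0 < \<beta>\<close> \<open>k < 0\<close> a const_r_bounds chord_less[OF ra] by (simp add: e_def)
    show "response_weight p0 p1 p2 x *
        ((?l x $ 1)^2 / response_weight p0 p1 p2 xU + (?l x $ 2)^2 / response_weight p0 p1 p2 x2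
          + (?l x $ 3)^2 / response_weight p0 p1 p2 xL) < 1"
      if x: "x \<in> {xL..xU}" "x \<notin> {xU, x2, xL}" for x
    proof -
      have "u xU < u x" "u x < u xL" unfolding mono using x by auto
      moreover have "u x < u x2 \<or> u x2 < u x" unfolding mono using x by auto
      ultimately have "r < u x" "u x < 1" "u x \<noteq> a" unfolding uxL uxU ux2 by auto
      then have "h r * (?l x $ 1)^2 + h a * (?l x $ 2)^2 + h 1 * (?l x $ 3)^2 < h (u x)"
        by (rule lagrange_bound[OF ra const_c_gt_1 const_delta_c_nonneg critical])
      then have "(h r * (?l x $ 1)^2 + h a * (?l x $ 2)^2 + h 1 * (?l x $ 3)^2) / h (u x) < 1"
        using hpos[OF ubounds[OF x(1)]] by (simp only: divide_less_eq_1_pos)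
      \<comment> \<open>With \<open>m = \<sigma>^2\<close>, the common scale of all weights
        cancels.\<close>
      moreover have "1 / (m * H) * (A / (1 / (m * h1)) + B / (1 / (m * h2)) + C / (1 / (m * h3)))
          = (h1 * A + h2 * B + h3 * C) / H" if "m \<noteq> 0" for m H A B C h1 h2 h3 :: real
        using that by (simp add: add_divide_distrib mult.commute)
      moreover have "\<sigma>^2 \<noteq> 0" by (rule power_not_zero[OF less_imp_neq[OF sigma_pos, symmetric]])
      ultimately show ?thesis
        unfolding response_weight_relative uxL uxU ux2 by presburger
    qed
  qed (use x2 xLU ux2 uxL uxU lagrange_nodes[OF ra] weight_pos in auto)
qed

end

theorem theorem2:
  fixes p0 p1 p2 xL xU :: real
  assumes "0 < p0" and "p0 < 1"
    and "1 / 2 < p1" and "p1 \<le> 1"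
    and "1 / 2 < p2" and "p2 \<le> 1"
    and "1 \<le> xL" and "xL < xU"
  shows "(\<exists>!\<xi>. D_optimal p0 p1 p2 xL xU \<xi>) \<and>
         (\<exists>!a. A1_root p0 p1 p2 xL xU a) \<and>
         (\<forall>\<xi> A1. D_optimal p0 p1 p2 xL xU \<xi> \<and> A1_root p0 p1 p2 xL xU A1 \<longrightarrow>
            (\<exists>x2. xL < x2 \<and> x2 < xU \<and>
                  x2 - xL = ln A1 / ln (1 - p0) \<and>
                  set_pmf \<xi> = {xL, x2, xU} \<and>
                  (\<forall>x\<in>{xL, x2, xU}. pmf \<xi> x = 1 / 3)))"
proof -
  note opt = D_optimal_iff_A1_root[OF assms]
  let ?x2 = "\<lambda>a. xL + ln a / ln (1 - p0)"
  have ex: "\<exists>a. A1_root p0 p1 p2 xL xU a"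
    using critical_point_exists[OF const_r_bounds[OF assms] const_c_gt_1[OF assms] const_delta_c_nonneg[OF assms]]
    unfolding A1_root_iff_critical[OF assms] by metis
  have "a = a'" if a: "A1_root p0 p1 p2 xL xU a" and a': "A1_root p0 p1 p2 xL xU a'" for a a'
  proof -
    have "pmf_of_set {xU, ?x2 a, xL} = pmf_of_set {xU, ?x2 a', xL}"
      using opt(3)[OF a] opt(3)[OF a'] by blast
    from arg_cong[OF this, of set_pmf] have "{xU, ?x2 a, xL} = {xU, ?x2 a', xL}"
      by simp
    \<comment> \<open>Both middle points lie strictly between the shared end points, so equal
      supports identify them.\<close>
    then have "?x2 a = ?x2 a'"
      using opt(1,2)[OF a] opt(1,2)[OF a'] by (metis insert_iff less_irrefl singletonD)
    then have "ln a = ln a'" using assms by simp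
    moreover have "0 < a" "0 < a'"
      using a a' const_r_bounds[OF assms] A1_root_iff_critical[OF assms] by (metis less_trans)+
    ultimately show ?thesis by simp
  qed
  moreover have "\<exists>x2. xL < x2 \<and> x2 < xU \<and> x2 - xL = ln a / ln (1 - p0) \<and> set_pmf \<xi> = {xL, x2, xU} \<and>
      (\<forall>x\<in>{xL, x2, xU}. pmf \<xi> x = 1 / 3)"
    if "D_optimal p0 p1 p2 xL xU \<xi>" and a: "A1_root p0 p1 p2 xL xU a" for \<xi> a
  proof (intro exI conjI)
    define x2 where "x2 = ?x2 a"
    have \<xi>: "\<xi> = pmf_of_set {xU, x2, xL}" using that opt(3)[OF a] by (simp add: x2_def)
    show "xL < x2" "x2 < xU" using opt(1,2)[OF a] by (simp_all add: x2_def)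
    then show "set_pmf \<xi> = {xL, x2, xU}" "\<forall>x\<in>{xL, x2, xU}. pmf \<xi> x = 1 / 3"
      unfolding \<xi> by auto
    show "x2 - xL = ln a / ln (1 - p0)" by (simp add: x2_def)
  qed
  moreover have "\<exists>!\<xi>. D_optimal p0 p1 p2 xL xU \<xi>"
    using ex opt(3) by auto
  ultimately show ?thesis using ex by blast
qed

end
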